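(* Let $k\geq 4$, and let $H$ be a $2$-covering $k$-hypergraph of order at least $k$ and size at least $2$. Then $H$ is quasi-eulerian.
   Context: A hypergraph $H=(V,E)$ has a non-empty finite vertex set $V$ and a finite collection $E$ of edges, each associated with a subset of $V$; parallel edges (distinct edges with the same vertex set) are allowed, so $E$ is a multiset of subsets of $V$. The order of $H$ is $|V|$ and its size is $|E|$ (counted with multiplicity). A $2$-covering $k$-hypergraph is a hypergraph with at least one edge in which every edge has exactly $k$ vertices and every $2$-subset of the vertex set is contained in at least one edge. A walk is a sequence $v_0e_1v_1\dots v_{r-1}e_rv_r$ ($r\ge 0$) of vertices $v_i$ and edges $e_i$ such that $v_{i-1}\neq v_i$ and $v_{i-1},v_i\in e_i$ for all $i=1,\dots,r$; its anchors are the vertices $v_0,\dots,v_r$; it is closed if $v_0=v_r$ and trivial if $r=0$. It is a strict trail if $e_1,\dots,e_r$ are pairwise distinct edges. An Euler family of $H$ is a collection of pairwise edge-disjoint and pairwise anchor-disjoint non-trivial closed strict trails of $H$ that jointly traverse every edge of $H$ (exactly once). $H$ is quasi-eulerian if it admits an Euler family. *)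

theory Defs
  imports Main
begin

text \<open>
  The edge multiset is represented by a finite set of edge names together with an incidence
  function giving the vertex set of each named edge. The incidence function need not be injective,
  so parallel edges are distinct names with the same vertex set, and the size is the number of names.
\<close>

record ('v, 'e) hypergraph =
  verts :: "'v set"
  edges :: "'e set"
  inc :: "'e \<Rightarrow> 'v set"

definition hypergraph :: "('v, 'e) hypergraph \<Rightarrow> bool" where
  "hypergraph H \<longleftrightarrow>
     finite (verts H) \<and> verts H \<noteq> {} \<and> finite (edges H) \<and> (\<forall>e\<in>edges H. inc H e \<subseteq> verts H)"

definition hg_order :: "('v, 'e) hypergraph \<Rightarrow> nat" where
  "hg_order H = card (verts H)"

definition hg_size :: "('v, 'e) hypergraph \<Rightarrow> nat" where
  "hg_size H = card (edges H)"

definition two_covering_hypergraph :: "nat \<Rightarrow> ('v, 'e) hypergraph \<Rightarrow> bool" where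
  "two_covering_hypergraph k H \<longleftrightarrow>
     hypergraph H \<and> edges H \<noteq> {} \<and>
     (\<forall>e\<in>edges H. card (inc H e) = k) \<and>
     (\<forall>P. P \<subseteq> verts H \<and> card P = 2 \<longrightarrow> (\<exists>e\<in>edges H. P \<subseteq> inc H e))"

text \<open>
  The walk \<open>v\<^sub>0 e\<^sub>1 v\<^sub>1 \<dots> e\<^sub>r v\<^sub>r\<close> is the pair \<open>([v\<^sub>0, \<dots>, v\<^sub>r], [e\<^sub>1, \<dots>, e\<^sub>r])\<close>; since lists are
  indexed from 0, the edge \<open>es ! i\<close> joins \<open>vs ! i\<close> and \<open>vs ! Suc i\<close>.
\<close>

type_synonym ('v, 'e) walk = "'v list \<times> 'e list"

definition is_walk :: "('v, 'e) hypergraph \<Rightarrow> ('v, 'e) walk \<Rightarrow> bool" where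
  "is_walk H W \<longleftrightarrow> (case W of (vs, es) \<Rightarrow>
     length vs = Suc (length es) \<and> set vs \<subseteq> verts H \<and> set es \<subseteq> edges H \<and>
     (\<forall>i<length es. vs ! i \<noteq> vs ! Suc i \<and> vs ! i \<in> inc H (es ! i) \<and> vs ! Suc i \<in> inc H (es ! i)))"

definition anchors :: "('v, 'e) walk \<Rightarrow> 'v set" where
  "anchors W = set (fst W)"

definition walk_edges :: "('v, 'e) walk \<Rightarrow> 'e set" where
  "walk_edges W = set (snd W)"

definition trivial_walk :: "('v, 'e) walk \<Rightarrow> bool" where
  "trivial_walk W \<longleftrightarrow> snd W = []"

definition closed_walk :: "('v, 'e) walk \<Rightarrow> bool" where
  "closed_walk W \<longleftrightarrow> hd (fst W) = last (fst W)"

definition strict_trail :: "('v, 'e) hypergraph \<Rightarrow> ('v, 'e) walk \<Rightarrow> bool" where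
  "strict_trail H W \<longleftrightarrow> is_walk H W \<and> distinct (snd W)"

text \<open>
  A set of trails suffices to represent the collection: non-trivial trails that are edge-disjoint
  are distinct. Edge-disjointness and strictness make each edge be traversed exactly once.
\<close>

definition euler_family :: "('v, 'e) hypergraph \<Rightarrow> ('v, 'e) walk set \<Rightarrow> bool" where
  "euler_family H F \<longleftrightarrow>
     (\<forall>W\<in>F. strict_trail H W \<and> closed_walk W \<and> \<not> trivial_walk W) \<and>
     pairwise (\<lambda>W W'. walk_edges W \<inter> walk_edges W' = {}) F \<and>
     pairwise (\<lambda>W W'. anchors W \<inter> anchors W' = {}) F \<and>
     (\<Union>W\<in>F. walk_edges W) = edges H"

definition quasi_eulerian :: "('v, 'e) hypergraph \<Rightarrow> bool" where
  "quasi_eulerian H \<longleftrightarrow> (\<exists>F. euler_family H F)"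

end

theory Submission
  imports Defs
begin

text \<open>
  Every edge of an Euler family is traversed from one of its vertices to another. Remembering only
  these two vertices turns each hyperedge \<open>e\<close> into an ordinary graph edge \<open>p e\<close>, and closedness
  makes all degrees even. Conversely, from a choice of a pair \<open>p e\<close> in every \<open>e\<close> with all degrees
  even (an \<open>even_choice\<close>), Euler tours of the components of the resulting multigraph form an Euler
  family (\<open>euler_family_of_even_pairs\<close>). So the task is to find an even choice.

  An even choice is a perfect matching of an auxiliary graph: every incidence of a vertex \<open>v\<close> with an
  edge \<open>e\<close> is a node \<open>Slot v e\<close>, the slots of one vertex form a clique, and every \<open>e\<close> has \<open>k - 2\<close>
  dummies adjacent to all its slots. The dummies use up all but two slots of \<open>e\<close>, and the clique
  edges pair up the other incidences at every vertex.

  If there is no perfect matching, Tutte's theorem yields a set \<open>S\<close> of nodes whose removal leaves more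
  than \<open>card S\<close> odd components. It is proved here by Lovasz' argument on an edge-maximal graph without
  perfect matching, and with a labelling of the nodes in place of the components, so that merging
  components is just relabelling. In a smallest such \<open>S\<close> every node of \<open>S\<close> sees at least three labels
  (\<open>barrier_with_three_labels\<close>). In the auxiliary graph this leaves only three kinds of edges: those
  with exactly their slots in \<open>S\<close> (the set \<open>A\<close>), those with exactly their dummies in \<open>S\<close> (the set \<open>B\<close>),
  and those that avoid \<open>S\<close>. The outcome is a labelling \<open>L\<close> of the vertices that is constant on every
  edge outside \<open>A\<close> and \<open>B\<close>, while the edges in \<open>B\<close> meet at least \<open>2 |A| + (k - 2) |B| + 2\<close> labels
  (\<open>even_choice_or_obstruction\<close>).

  In a 2-covering hypergraph this is impossible. Take one vertex for each of these \<open>t\<close> labels. Every two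
  of them lie in a common edge, which must belong to \<open>A\<close> or \<open>B\<close>, so
  \<open>t (t - 1) \<le> (|A| + |B|) k (k - 1)\<close>; also \<open>t \<le> k |B|\<close>. For \<open>k \<ge> 4\<close> these bounds leave only \<open>A = {}\<close> and
  \<open>B = {e}\<close>, with all vertices of \<open>e\<close> carrying different labels. But a vertex outside \<open>e\<close> shares an edge
  other than \<open>e\<close> with each vertex of \<open>e\<close>, which forces equal labels; and if there is no vertex
  outside \<open>e\<close>, a second edge is parallel to \<open>e\<close> and forces equal labels, too.
\<close>

section \<open>Perfect matchings and the exchange argument\<close>

text \<open>
  A matching is an involution, so that alternating between two matchings is iterating a composition.
  Loops in \<open>R\<close> never help, since fixed points are excluded separately.
\<close>

definition perfect_matching :: "('a \<times> 'a) set \<Rightarrow> 'a set \<Rightarrow> ('a \<Rightarrow> 'a) \<Rightarrow> bool" where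
  "perfect_matching R X f \<longleftrightarrow>
     (\<forall>x\<in>X. f x \<in> X \<and> f (f x) = x \<and> f x \<noteq> x \<and> (x, f x) \<in> R)"

definition matchable :: "('a \<times> 'a) set \<Rightarrow> 'a set \<Rightarrow> bool" where
  "matchable R X \<longleftrightarrow> (\<exists>f. perfect_matching R X f)"

text \<open>
  If \<open>f\<close> and \<open>g\<close> are matchings, the walk \<open>d, f d, g (f d), \<dots>\<close> returns to \<open>g d\<close> only after an odd number
  of steps, since alternating cycles have even length. Read from both ends, a walk that reached
  \<open>g d\<close> after an even number of steps would be palindromic and would have a fixed point in its middle;
  the induction removes two steps at either end.
\<close>

lemma alternating_orbit_avoids_partner:
  assumes f: "\<And>x. x \<in> X \<Longrightarrow> f x \<in> X \<and> f (f x) = x \<and> f x \<noteq> x"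
    and g: "\<And>x. x \<in> X \<Longrightarrow> g x \<in> X \<and> g (g x) = x \<and> g x \<noteq> x"
    and "d \<in> X"
  shows "((g \<circ> f) ^^ i) d \<noteq> g d"
  using \<open>d \<in> X\<close>
proof (induction i arbitrary: d rule: less_induct)
  case (less i)
  show ?case
  proof
    assume eq: "((g \<circ> f) ^^ i) d = g d"
    have in_X: "((g \<circ> f) ^^ j) x \<in> X" if "x \<in> X" for j x
      using that f g by (induction j) auto
    consider "i = 0" | "i = 1" | j where "i = Suc (Suc j)"
      by (metis One_nat_def not0_implies_Suc)
    then show False
    proof cases
      case 1
      with eq have "g d = d" by simp
      then show False using g less.prems by blast
    next
      case 2
      with eq have "g (f d) = g d" by simp
      then show False using f g less.prems by metis
    next
      case 3
      define d' where "d' = g (f d)"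
      define y where "y = ((g \<circ> f) ^^ j) d'"
      have "d' \<in> X" using f g less.prems by (simp add: d'_def)
      then have y: "y \<in> X" using in_X by (simp add: y_def)
      have "((g \<circ> f) ^^ i) d = g (f y)"
        using funpow_swap1[of "g \<circ> f" j d] by (simp add: 3 y_def d'_def)
      with eq have "g (f y) = g d" by simp
      then have "f y = d" using f g y less.prems by metis
      then have "y = f d" using f y by metis
      also have "\<dots> = g d'" using f g less.prems by (simp add: d'_def)
      finally show False
        using less.IH[of j d'] 3 \<open>d' \<in> X\<close> by (simp add: y_def)
    qed
  qed
qed

text \<open>
  The heart of Lovasz' proof of Tutte's theorem. One matching uses the missing edge \<open>ac\<close>, the other
  the missing edge \<open>bd\<close>. Start at \<open>d\<close> and alternate between them, beginning with \<open>f\<close>. If the alternating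
  cycle of \<open>d\<close> avoids \<open>a\<close> and \<open>c\<close>, use \<open>f\<close> on it and \<open>g\<close> elsewhere. Otherwise stop at the
  first of \<open>a\<close>, \<open>c\<close> that is met, close the path through \<open>b\<close> by the edge \<open>ab\<close> or \<open>cb\<close>, and use this edge
  and \<open>f\<close> on the path and \<open>g\<close> elsewhere. Neither missing edge is used.
\<close>

lemma matchable_by_exchange:
  assumes fin: "finite X" and "sym R"
    and f: "perfect_matching (R \<union> {(a, c), (c, a)}) X f"
    and g: "perfect_matching (R \<union> {(b, d), (d, b)}) X g"
    and ab: "(a, b) \<in> R" and bc: "(b, c) \<in> R"
    and N: "a \<in> X" "b \<in> X" "c \<in> X" "d \<in> X"
  shows "matchable R X"
proof (rule ccontr)
  assume no: "\<not> matchable R X"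
  have f': "f x \<in> X \<and> f (f x) = x \<and> f x \<noteq> x" if "x \<in> X" for x
    using f that by (auto simp: perfect_matching_def)
  have g': "g x \<in> X \<and> g (g x) = x \<and> g x \<noteq> x" if "x \<in> X" for x
    using g that by (auto simp: perfect_matching_def)
  have fR: "(x, f x) \<in> R" if "x \<in> X" "x \<noteq> a" "x \<noteq> c" for x
    using f that by (auto simp: perfect_matching_def)
  have gR: "(x, g x) \<in> R" if "x \<in> X" "x \<noteq> b" "x \<noteq> d" for x
    using g that by (auto simp: perfect_matching_def)
  have "\<exists>x\<in>X. (x, f x) \<notin> R"
    using no f' unfolding matchable_def perfect_matching_def by blast
  then have fac: "f a = c" "f c = a"
    using f f' unfolding perfect_matching_def by blast+
  have "\<exists>x\<in>X. (x, g x) \<notin> R"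
    using no g' unfolding matchable_def perfect_matching_def by blast
  then have gbd: "g b = d" "g d = b"
    using g g' unfolding perfect_matching_def by blast+
  define h where "h i = ((g \<circ> f) ^^ i) d" for i :: nat
  have h0: "h 0 = d" and hS: "h (Suc i) = g (f (h i))" for i
    by (simp_all add: h_def)
  have hX: "h i \<in> X" for i
    by (induction i) (use N f' g' in \<open>auto simp: h0 hS\<close>)
  have h_ne_b: "h i \<noteq> b" for i
    using alternating_orbit_avoids_partner[of X f g d i] f' g' N gbd by (auto simp: h_def)
  have h_add: "h (i + l) = h l" if "h i = d" for i l
    by (induction l) (auto simp: that h0 hS)
  have g_h: "g (h (Suc i)) = f (h i)" for i
    using hX f' g' by (simp add: hS)
  show False
  proof (cases "\<exists>j. h j \<in> {a, c}")
    case True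
    \<comment> \<open>Only even positions need to be inspected: \<open>f\<close> swaps \<open>a\<close> and \<open>c\<close>, so an odd position in \<open>{a, c}\<close>
      is preceded by an even one.\<close>
    define j where "j = (LEAST j. h j \<in> {a, c})"
    have j: "h j \<in> {a, c}" unfolding j_def using True by (rule LeastI_ex)
    have below: "h i \<noteq> a" "h i \<noteq> c" if "i < j" for i
      using that not_less_Least[of i "\<lambda>j. h j \<in> {a, c}"] by (auto simp: j_def)
    have below_f: "f (h i) \<noteq> a" "f (h i) \<noteq> c" if "i < j" for i
      using below[OF that] f' hX fac by metis+
    have below_b: "f (h i) \<noteq> b" if "i < j" for i
    proof
      assume "f (h i) = b"
      then have "h (Suc i) = d" by (simp add: hS gbd)
      from h_add[OF this, of "j - Suc i"] that have "h j = h (j - Suc i)" by simp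
      with j below[of "j - Suc i"] that show False by auto
    qed
    define Y where "Y = insert b (h ` {..j} \<union> (f \<circ> h) ` {..<j})"
    have gY: "g y \<in> Y" if "y \<in> Y" for y
    proof -
      consider "y = b" | i where "y = h i" "i \<le> j" | i where "y = f (h i)" "i < j"
        using \<open>y \<in> Y\<close> by (auto simp: Y_def)
      then show ?thesis
      proof cases
        case 1
        then show ?thesis using gbd h0 by (force simp: Y_def)
      next
        case 2
        then show ?thesis
          by (cases i) (auto simp: Y_def h0 gbd g_h)
      next
        case 3
        then have "g y = h (Suc i)" by (simp add: hS)
        then show ?thesis using 3 by (auto simp: Y_def)
      qed
    qed
    have gY': "g y \<notin> Y" if "y \<in> X" "y \<notin> Y" for y
      using gY[of "g y"] g' that by auto
    have fY: "f y \<in> Y \<and> f y \<noteq> h j \<and> f y \<noteq> b \<and> (y, f y) \<in> R"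
      if "y \<in> Y" "y \<noteq> h j" "y \<noteq> b" for y
    proof -
      consider i where "y = h i" "i < j" | i where "y = f (h i)" "i < j"
        using \<open>y \<in> Y\<close> \<open>y \<noteq> h j\<close> \<open>y \<noteq> b\<close> by (auto simp: Y_def) (metis le_neq_implies_less)
      then show ?thesis
      proof cases
        case 1
        then show ?thesis
          using j below below_f below_b fR hX by (auto simp: Y_def)
      next
        case 2
        then have "f y = h i" using f' hX by simp
        then show ?thesis
          using 2 j below[of i] below_f[of i] fR[of y] f' hX h_ne_b by (auto simp: Y_def)
      qed
    qed
    have hjb: "(h j, b) \<in> R" "(b, h j) \<in> R"
      using j ab bc \<open>sym R\<close> by (auto dest: symD)
    define m where "m y = (if y \<notin> Y then g y else if y = h j then b else if y = b then h j else f y)"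
      for y
    have "perfect_matching R X m"
      unfolding perfect_matching_def
    proof
      fix y assume y: "y \<in> X"
      have bY: "b \<in> Y" "d \<in> Y" "h j \<in> Y" using h0 by (force simp: Y_def)+
      consider "y \<notin> Y" | "y = h j" | "y = b" | "y \<in> Y" "y \<noteq> h j" "y \<noteq> b" by blast
      then show "m y \<in> X \<and> m (m y) = y \<and> m y \<noteq> y \<and> (y, m y) \<in> R"
      proof cases
        case 1
        then show ?thesis using gY' g' gR[of y] bY y by (auto simp: m_def)
      next
        case 2
        then show ?thesis using h_ne_b bY N hjb by (auto simp: m_def)
      next
        case 3
        then show ?thesis using h_ne_b bY hX hjb by (auto simp: m_def)
      next
        case 4
        then show ?thesis using fY[OF 4] f' y by (auto simp: m_def)
      qed
    qed
    then show False using no by (auto simp: matchable_def)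
  next
    case False
    \<comment> \<open>The orbit is a full alternating cycle that contains \<open>b\<close> and \<open>d\<close> but not \<open>a\<close> and \<open>c\<close>.\<close>
    then have ha: "h i \<noteq> a" "h i \<noteq> c" for i by auto
    then have hf: "f (h i) \<noteq> a" "f (h i) \<noteq> c" for i
      using f' hX fac by metis+
    have "\<exists>i. h (Suc i) = d"
    proof -
      have "finite (range h)" using fin hX by (auto intro: finite_subset)
      then have "\<not> inj h" using finite_imageD infinite_UNIV_nat by blast
      then obtain i l where "h i = h (i + Suc l)"
        by (metis injI less_iff_Suc_add linorder_neqE_nat add_Suc_right)
      then have "h 0 = h (Suc l)"
      proof (induction i)
        case (Suc i)
        have "f (h i) = f (h (i + Suc l))"
          using Suc.prems hX f' g' unfolding add_Suc hS by metis
        then have "h i = h (i + Suc l)" using hX f' by metis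
        then show ?case by (rule Suc.IH)
      qed simp
      then show ?thesis using h0 by metis
    qed
    then obtain i0 where i0: "h (Suc i0) = d" ..
    define Y where "Y = range h \<union> range (f \<circ> h)"
    have fY: "f y \<in> Y" if "y \<in> Y" for y
      using that f' hX by (auto simp: Y_def)
    have gY: "g y \<in> Y" if "y \<in> Y" for y
    proof -
      consider "y = d" | i where "y = h (Suc i)" | i where "y = f (h i)"
        using \<open>y \<in> Y\<close> h0 by (auto simp: Y_def) (metis not0_implies_Suc)
      then show ?thesis
      proof cases
        case 1
        then show ?thesis using g_h[of i0] i0 by (auto simp: Y_def)
      next
        case 2
        then show ?thesis by (auto simp: Y_def g_h)
      next
        case 3
        then have "g y = h (Suc i)" by (simp add: hS)
        then show ?thesis by (auto simp: Y_def)
      qed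
    qed
    have gY': "g y \<notin> Y" if "y \<in> X" "y \<notin> Y" for y
      using gY[of "g y"] g' that by auto
    have dY: "d \<in> Y" using h0 by (force simp: Y_def)
    then have bY: "b \<in> Y" using gY gbd by metis
    have "perfect_matching R X (\<lambda>y. if y \<in> Y then f y else g y)"
      unfolding perfect_matching_def
    proof
      fix y assume y: "y \<in> X"
      show "(if y \<in> Y then f y else g y) \<in> X \<and>
         (if (if y \<in> Y then f y else g y) \<in> Y then f (if y \<in> Y then f y else g y)
          else g (if y \<in> Y then f y else g y)) = y \<and>
         (if y \<in> Y then f y else g y) \<noteq> y \<and> (y, if y \<in> Y then f y else g y) \<in> R"
      proof (cases "y \<in> Y")
        case True
        then have "y \<noteq> a" "y \<noteq> c" using ha hf by (auto simp: Y_def)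
        then show ?thesis using True y f' fY fR by auto
      next
        case False
        then have "y \<noteq> b" "y \<noteq> d" using bY dY by auto
        then show ?thesis using False y g' gY' gR by auto
      qed
    qed
    then show False using no by (auto simp: matchable_def)
  qed
qed

section \<open>Barriers in graphs without a perfect matching\<close>

lemma matchable_Un:
  assumes "matchable R X" "matchable R Y" "X \<inter> Y = {}"
  shows "matchable R (X \<union> Y)"
proof -
  from assms obtain f g where f: "perfect_matching R X f" and g: "perfect_matching R Y g"
    by (auto simp: matchable_def)
  have "perfect_matching R (X \<union> Y) (\<lambda>x. if x \<in> X then f x else g x)"
    using f g \<open>X \<inter> Y = {}\<close> by (auto simp: perfect_matching_def)
  then show ?thesis by (auto simp: matchable_def)
qed

lemma matchable_pair:
  assumes "x \<noteq> y" "(x, y) \<in> R" "sym R"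
  shows "matchable R {x, y}"
proof -
  have "perfect_matching R {x, y} (\<lambda>z. if z = x then y else x)"
    using assms by (auto simp: perfect_matching_def dest: symD)
  then show ?thesis by (auto simp: matchable_def)
qed

text \<open>
  Within cliques of even size nodes can be paired off two at a time. The parity of \<open>X\<close> is
  carried along because the same induction gives it.
\<close>

lemma matchable_even_classes:
  assumes "finite X" "sym R"
    and "\<And>x. x \<in> X \<Longrightarrow> even (card {y \<in> X. c y = c x})"
    and "\<And>x y. x \<in> X \<Longrightarrow> y \<in> X \<Longrightarrow> x \<noteq> y \<Longrightarrow> c x = c y \<Longrightarrow> (x, y) \<in> R"
  shows "matchable R X \<and> even (card X)"
  using assms(1,3,4)
proof (induction X rule: finite_psubset_induct)
  case (psubset X)
  show ?case
  proof (cases "X = {}")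
    case True
    then show ?thesis by (simp add: matchable_def perfect_matching_def)
  next
    case False
    then obtain x where x: "x \<in> X" by blast
    have "{y \<in> X. c y = c x} \<noteq> {x}"
      using psubset.prems(1)[OF x] by auto
    then obtain y where y: "y \<in> X" "c y = c x" "y \<noteq> x" using x by blast
    let ?Y = "X - {x, y}"
    have even: "even (card {w \<in> ?Y. c w = c z})" if z: "z \<in> ?Y" for z
    proof (cases "c z = c x")
      case True
      have "{w \<in> ?Y. c w = c z} = {w \<in> X. c w = c z} - {x, y}" by blast
      moreover have "{x, y} \<subseteq> {w \<in> X. c w = c z}" using x y True by auto
      ultimately have "card {w \<in> ?Y. c w = c z} = card {w \<in> X. c w = c z} - 2"
        using y(3) by (simp add: card_Diff_subset)
      then show ?thesis using psubset.prems(1)[of z] z by simp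
    next
      case False
      then have "{w \<in> ?Y. c w = c z} = {w \<in> X. c w = c z}" using y by auto
      then show ?thesis using psubset.prems(1)[of z] z by simp
    qed
    have IH: "matchable R ?Y \<and> even (card ?Y)"
      by (rule psubset.IH) (use x even psubset.prems(2) in auto)
    have "(x, y) \<in> R" using psubset.prems(2) x y by metis
    then have "matchable R {x, y}" using y \<open>sym R\<close> by (intro matchable_pair) auto
    then have "matchable R (?Y \<union> {x, y})" using IH by (intro matchable_Un) auto
    moreover have X: "?Y \<union> {x, y} = X" using x y by auto
    moreover have "card X = card ?Y + 2"
    proof -
      have "card (?Y \<union> {x, y}) = card ?Y + card {x, y}"
        using psubset.hyps by (intro card_Un_disjoint) auto
      moreover have "card {x, y} = 2" using y by simp
      ultimately show ?thesis unfolding X by simp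
    qed
    ultimately show ?thesis using IH by simp
  qed
qed

definition odd_labels :: "'a set \<Rightarrow> ('a \<Rightarrow> 'l) \<Rightarrow> 'l set" where
  "odd_labels X c = {l. odd (card {x \<in> X. c x = l})}"

lemma odd_labels_subset: "odd_labels X c \<subseteq> c ` X"
proof
  fix l assume "l \<in> odd_labels X c"
  then have "{x \<in> X. c x = l} \<noteq> {}"
    unfolding odd_labels_def by (auto dest!: odd_card_imp_not_empty)
  then show "l \<in> c ` X" by auto
qed

lemma even_card_iff_even_odd_labels:
  assumes "finite X"
  shows "even (card X) \<longleftrightarrow> even (card (odd_labels X c))"
proof -
  have "card X = (\<Sum>l\<in>c ` X. card {x \<in> X. c x = l})"
    using sum.image_gen[OF assms, of "\<lambda>_. 1::nat" c] by simp
  then have "even (card X) \<longleftrightarrow> even (card {l \<in> c ` X. odd (card {x \<in> X. c x = l})})"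
    using assms by (simp add: even_sum_iff)
  also have "{l \<in> c ` X. odd (card {x \<in> X. c x = l})} = odd_labels X c"
    using odd_labels_subset[of X c] by (auto simp: odd_labels_def)
  finally show ?thesis .
qed

text \<open>
  The labels stand for unions of components of the graph without \<open>S\<close>. Allowing unions loses nothing:
  every odd union contains an odd component.
\<close>

definition barrier :: "('a \<times> 'a) set \<Rightarrow> 'a set \<Rightarrow> 'a set \<Rightarrow> ('a \<Rightarrow> 'l) \<Rightarrow> bool" where
  "barrier R X S c \<longleftrightarrow> S \<subseteq> X \<and>
     (\<forall>x\<in>X - S. \<forall>y\<in>X - S. (x, y) \<in> R \<longrightarrow> c x = c y) \<and> card S < card (odd_labels (X - S) c)"

text \<open>
  The condition of Tutte's theorem suffices if the label classes are cliques and the nodes in \<open>U\<close> are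
  adjacent to everything: one node of every odd clique is matched into \<open>U\<close>, and what remains of each
  clique and of \<open>U\<close> is even.
\<close>

lemma matchable_if_cliques:
  assumes fin: "finite X" and "even (card X)" and "sym R" and "U \<subseteq> X"
    and U: "\<And>x y. x \<in> U \<Longrightarrow> y \<in> X \<Longrightarrow> (x, y) \<in> R"
    and cliques: "\<And>x y. x \<in> X - U \<Longrightarrow> y \<in> X - U \<Longrightarrow> c x = c y \<Longrightarrow> (x, y) \<in> R"
    and few: "card (odd_labels (X - U) c) \<le> card U"
  shows "matchable R X"
proof -
  let ?O = "odd_labels (X - U) c"
  have finU: "finite U" using fin \<open>U \<subseteq> X\<close> finite_subset by blast
  have finO: "finite ?O" using odd_labels_subset[of "X - U" c] fin by (meson finite_Diff finite_imageI finite_subset)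
  obtain V where V: "V \<subseteq> U" "card V = card ?O" using few obtain_subset_with_card_n by metis
  then obtain \<phi> where \<phi>: "bij_betw \<phi> ?O V"
    using finO finU finite_subset finite_same_card_bij by metis
  define r where "r l = (SOME x. x \<in> X - U \<and> c x = l)" for l
  have r: "r l \<in> X - U \<and> c (r l) = l" if "l \<in> ?O" for l
  proof -
    have "\<exists>x. x \<in> X - U \<and> c x = l" using that odd_labels_subset[of "X - U" c] by blast
    then show ?thesis unfolding r_def by (rule someI_ex)
  qed
  let ?Z = "r ` ?O"
  have Z: "?Z \<subseteq> X - U" using r by auto
  have cZ: "c z = l \<longleftrightarrow> z = r l" if "z \<in> ?Z" "l \<in> ?O" for z l using that r by auto
  have A: "matchable R (X - U - ?Z) \<and> even (card (X - U - ?Z))"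
  proof (rule matchable_even_classes[where c = c])
    fix x assume x: "x \<in> X - U - ?Z"
    let ?C = "{y \<in> X - U. c y = c x}"
    show "even (card {y \<in> X - U - ?Z. c y = c x})"
    proof (cases "c x \<in> ?O")
      case True
      then have "{y \<in> X - U - ?Z. c y = c x} = ?C - {r (c x)}"
        using cZ by blast
      moreover have "r (c x) \<in> ?C" using r[OF True] by simp
      moreover have "odd (card ?C)" using True by (simp add: odd_labels_def)
      ultimately show ?thesis using fin by (simp add: card_Diff_singleton)
    next
      case False
      then have "{y \<in> X - U - ?Z. c y = c x} = ?C" using r by auto
      then show ?thesis using False by (simp add: odd_labels_def)
    qed
  qed (use fin \<open>sym R\<close> cliques in auto)
  have "matchable R (r ` L \<union> \<phi> ` L)" if "L \<subseteq> ?O" for L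
  proof -
    have "finite L" using that finO finite_subset by blast
    then show ?thesis using that
    proof (induction L rule: finite_induct)
      case empty
      then show ?case by (simp add: matchable_def perfect_matching_def)
    next
      case (insert l L)
      have "\<phi> l \<in> U" using \<phi> V insert.prems by (auto simp: bij_betw_def)
      moreover have rl: "r l \<in> X - U" using r insert.prems by auto
      ultimately have "matchable R {r l, \<phi> l}"
        using U \<open>sym R\<close> by (intro matchable_pair) (auto dest: symD)
      moreover have "\<phi> l \<notin> \<phi> ` L"
        using \<phi> insert by (auto simp: bij_betw_def dest: inj_onD)
      moreover have "r l \<notin> r ` L"
      proof
        assume "r l \<in> r ` L"
        then obtain l' where "l' \<in> L" "r l = r l'" by blast
        then have "l = l'" using r insert.prems by (metis insert_subset subsetD)
        then show False using \<open>l' \<in> L\<close> insert.hyps by simp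
      qed
      moreover have "\<phi> ` L \<subseteq> U" "r ` L \<inter> U = {}"
        using \<phi> V insert.prems r by (auto simp: bij_betw_def)
      ultimately have "(r ` L \<union> \<phi> ` L) \<inter> {r l, \<phi> l} = {}" "matchable R {r l, \<phi> l}"
        using rl \<open>\<phi> l \<in> U\<close> by auto
      then have "matchable R ((r ` L \<union> \<phi> ` L) \<union> {r l, \<phi> l})"
        using insert.IH insert.prems by (intro matchable_Un[of _ "r ` L \<union> \<phi> ` L"]) auto
      moreover have "(r ` L \<union> \<phi> ` L) \<union> {r l, \<phi> l} = r ` insert l L \<union> \<phi> ` insert l L" by auto
      ultimately show ?case by simp
    qed
  qed
  then have B: "matchable R (?Z \<union> V)" using \<phi> by (auto simp: bij_betw_def)
  have C: "even (card (U - V))"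
  proof -
    have "even (card (X - U)) \<longleftrightarrow> even (card ?O)"
      using fin by (intro even_card_iff_even_odd_labels) auto
    moreover have "card (X - U) + card U = card X"
      using fin \<open>U \<subseteq> X\<close> by (simp add: card_Diff_subset card_mono finU)
    moreover have "card (U - V) + card V = card U"
      using V finU card_mono[of U V] by (simp add: card_Diff_subset finite_subset)
    ultimately show ?thesis using V(2) \<open>even (card X)\<close> by (metis even_add)
  qed
  have "matchable R (U - V) \<and> even (card (U - V))"
  proof (rule matchable_even_classes[where c = "\<lambda>_. ()"])
    show "even (card {y \<in> U - V. () = ()})" using C by (simp add: set_diff_eq)
  qed (use finU \<open>sym R\<close> U \<open>U \<subseteq> X\<close> in auto)
  moreover have "matchable R ((X - U - ?Z) \<union> (?Z \<union> V))"
    using A B V Z by (intro matchable_Un[of _ _ "?Z \<union> V"]) auto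
  ultimately have "matchable R ((X - U - ?Z) \<union> (?Z \<union> V) \<union> (U - V))"
    using V Z by (intro matchable_Un[of _ "(X - U - ?Z) \<union> (?Z \<union> V)"]) auto
  moreover have "(X - U - ?Z) \<union> (?Z \<union> V) \<union> (U - V) = X" using V Z \<open>U \<subseteq> X\<close> by auto
  ultimately show ?thesis by simp
qed

text \<open>
  The hard direction of Tutte's theorem. In an edge-maximal graph without perfect matching let \<open>U\<close> be the set of nodes adjacent
  to everything. Adjacency is transitive on the other nodes, for a violation \<open>xyz\<close> together with a
  non-neighbour \<open>w\<close> of \<open>y\<close> would allow an exchange between matchings that use the new edges \<open>xz\<close>
  and \<open>yw\<close>. So the nodes outside \<open>U\<close> form cliques, and too few odd cliques would give a perfect
  matching. A maximal graph contains all loops, which makes adjacency reflexive.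
\<close>

theorem barrier_if_not_matchable:
  fixes R :: "('a \<times> 'a) set"
  assumes fin: "finite X" and "even (card X)" and "sym R" and "R \<subseteq> X \<times> X"
    and "\<not> matchable R X"
  shows "\<exists>S (c :: 'a \<Rightarrow> 'a set). barrier R X S c"
proof -
  let ?\<R> = "{M. M \<subseteq> X \<times> X \<and> sym M \<and> \<not> matchable M X}"
  have "finite ?\<R>" using fin by simp
  then obtain M where M: "M \<in> ?\<R>" "R \<subseteq> M" and max: "\<And>M'. M' \<in> ?\<R> \<Longrightarrow> M \<subseteq> M' \<Longrightarrow> M = M'"
    using finite_has_maximal2[of ?\<R> R] assms by auto
  then have symM: "sym M" and noM: "\<not> matchable M X" and MX: "M \<subseteq> X \<times> X" by auto
  have loops: "(x, x) \<in> M" if "x \<in> X" for x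
  proof -
    have "\<not> matchable (insert (x, x) M) X"
      using noM by (auto simp: matchable_def perfect_matching_def)
    moreover have "sym (insert (x, x) M)" using symM by (auto simp: sym_def)
    moreover have "insert (x, x) M \<subseteq> X \<times> X" using MX that by auto
    ultimately have "M = insert (x, x) M" by (intro max) auto
    then show ?thesis by blast
  qed
  have add: "matchable (M \<union> {(x, y), (y, x)}) X" if "x \<in> X" "y \<in> X" "(x, y) \<notin> M" for x y
  proof (rule ccontr)
    assume "\<not> ?thesis"
    moreover have "sym (M \<union> {(x, y), (y, x)})" using symM by (auto simp: sym_def)
    moreover have "M \<union> {(x, y), (y, x)} \<subseteq> X \<times> X" using MX that by auto
    ultimately have "M = M \<union> {(x, y), (y, x)}" by (intro max) auto
    then show False using that by blast
  qed
  define U where "U = {x \<in> X. \<forall>y\<in>X. (x, y) \<in> M}"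
  have trans: "(x, z) \<in> M"
    if "x \<in> X" "y \<in> X - U" "z \<in> X" "(x, y) \<in> M" "(y, z) \<in> M" for x y z
  proof (rule ccontr)
    assume xz: "(x, z) \<notin> M"
    obtain w where w: "w \<in> X" "(y, w) \<notin> M" using \<open>y \<in> X - U\<close> by (auto simp: U_def)
    obtain f g where "perfect_matching (M \<union> {(x, z), (z, x)}) X f"
      "perfect_matching (M \<union> {(y, w), (w, y)}) X g"
      using add[OF \<open>x \<in> X\<close> \<open>z \<in> X\<close> xz] add[OF _ w] \<open>y \<in> X - U\<close> unfolding matchable_def by blast
    then have "matchable M X"
      using matchable_by_exchange[OF fin symM] that w by auto
    then show False using noM by simp
  qed
  define c where "c x = {y \<in> X - U. (x, y) \<in> M}" for x
  have c_eq: "c x = c y \<longleftrightarrow> (x, y) \<in> M" if "x \<in> X - U" "y \<in> X - U" for x y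
  proof
    assume "c x = c y"
    then show "(x, y) \<in> M" using loops that by (auto simp: c_def)
  next
    assume "(x, y) \<in> M"
    then have "(y, x) \<in> M" using symM by (auto dest: symD)
    show "c x = c y"
    proof -
      have "(x, z) \<in> M \<longleftrightarrow> (y, z) \<in> M" if "z \<in> X - U" for z
        using trans[of x y z] trans[of y x z] \<open>(x, y) \<in> M\<close> \<open>(y, x) \<in> M\<close> that
          \<open>x \<in> X - U\<close> \<open>y \<in> X - U\<close> by blast
      then show ?thesis by (auto simp: c_def)
    qed
  qed
  have "card U < card (odd_labels (X - U) c)"
  proof (rule ccontr)
    assume "\<not> ?thesis"
    then have "matchable M X"
      using fin \<open>even (card X)\<close> symM c_eq by (intro matchable_if_cliques[of X M U c]) (auto simp: U_def)
    then show False using noM by simp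
  qed
  then have "barrier R X U c" using c_eq \<open>R \<subseteq> M\<close> by (auto simp: barrier_def U_def)
  then show ?thesis by blast
qed

text \<open>
  Returning \<open>x\<close> to the graph merges at most two label classes with it. If both are odd, so is the
  merged class; hence at most one odd label is lost, while \<open>S\<close> loses one node.
\<close>

lemma barrier_remove:
  fixes c :: "'a \<Rightarrow> 'l"
  assumes fin: "finite X" and bar: "barrier R X S c" and "sym R" and "x \<in> S"
    and nbrs: "\<And>y. y \<in> X - S \<Longrightarrow> (x, y) \<in> R \<Longrightarrow> c y \<in> {l1, l2}"
  shows "\<exists>c' :: 'a \<Rightarrow> 'l. barrier R X (S - {x}) c'"
proof -
  define c' where "c' y = (if y = x \<or> c y = l2 then l1 else c y)" for y
  let ?T = "X - (S - {x})"
  have S: "S \<subseteq> X" using bar by (simp add: barrier_def)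
  then have T: "?T = insert x (X - S)" using \<open>x \<in> S\<close> by auto
  let ?C = "\<lambda>l. {y \<in> X - S. c y = l}"
  have same: "{y \<in> ?T. c' y = l} = ?C l" if "l \<noteq> l1" "l \<noteq> l2" for l
    unfolding T using that \<open>x \<in> S\<close> by (auto simp: c'_def)
  have C1: "{y \<in> ?T. c' y = l1} = insert x (?C l1 \<union> ?C l2)"
    unfolding T by (auto simp: c'_def)
  have "\<exists>l. odd_labels (X - S) c - {l} \<subseteq> odd_labels ?T c'"
  proof (cases "l1 \<noteq> l2 \<and> odd (card (?C l1)) \<and> odd (card (?C l2))")
    case True
    have "card (?C l1 \<union> ?C l2) = card (?C l1) + card (?C l2)"
      using True fin by (intro card_Un_disjoint) auto
    then have "odd (card {y \<in> ?T. c' y = l1})"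
      unfolding C1 using True fin \<open>x \<in> S\<close> by simp
    then have "l \<in> odd_labels ?T c'" if "l \<in> odd_labels (X - S) c" "l \<noteq> l2" for l
      using that same[of l] by (cases "l = l1") (simp_all add: odd_labels_def)
    then have "odd_labels (X - S) c - {l2} \<subseteq> odd_labels ?T c'" by blast
    then show ?thesis ..
  next
    case False
    then obtain l where l: "\<And>l'. l' = l1 \<or> l' = l2 \<Longrightarrow> l' \<noteq> l \<Longrightarrow> even (card (?C l'))" by metis
    have "l' \<in> odd_labels ?T c'" if "l' \<in> odd_labels (X - S) c" "l' \<noteq> l" for l'
    proof -
      have "l' \<noteq> l1" "l' \<noteq> l2" using l[of l'] that by (auto simp: odd_labels_def)
      then show ?thesis using that same[of l'] unfolding odd_labels_def mem_Collect_eq by metis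
    qed
    then have "odd_labels (X - S) c - {l} \<subseteq> odd_labels ?T c'" by blast
    then show ?thesis ..
  qed
  then obtain l where l: "odd_labels (X - S) c - {l} \<subseteq> odd_labels ?T c'" ..
  have fins: "finite (odd_labels ?T c')" "finite (odd_labels (X - S) c)" "finite S"
    using odd_labels_subset[of ?T c'] odd_labels_subset[of "X - S" c] fin S
    by (meson finite_Diff finite_imageI finite_subset)+
  have "card (odd_labels (X - S) c) - 1 \<le> card (odd_labels ?T c')"
    using card_mono[OF fins(1) l] fins(2) by (cases "l \<in> odd_labels (X - S) c") auto
  moreover have "card S = Suc (card (S - {x}))"
    using fins \<open>x \<in> S\<close> by (metis card_Suc_Diff1)
  ultimately have "card (S - {x}) < card (odd_labels ?T c')"
    using bar by (auto simp: barrier_def)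
  moreover have "c' y = c' z" if "y \<in> ?T" "z \<in> ?T" "(y, z) \<in> R" for y z
  proof -
    have c: "c u = c v" if "u \<in> X - S" "v \<in> X - S" "(u, v) \<in> R" for u v
      using bar that by (auto simp: barrier_def)
    have "(z, y) \<in> R" using that \<open>sym R\<close> by (auto dest: symD)
    then show ?thesis
      using that T c[of y z] nbrs[of y] nbrs[of z] by (auto simp: c'_def)
  qed
  ultimately have "barrier R X (S - {x}) c'" using S by (auto simp: barrier_def)
  then show ?thesis by blast
qed

text \<open>
  For even graphs, parity turns a surplus of one odd label into a surplus of two.
\<close>

lemma barrier_surplus:
  assumes fin: "finite X" and "even (card X)" and bar: "barrier R X S c"
  shows "card S + 2 \<le> card (odd_labels (X - S) c)"
proof -
  have "S \<subseteq> X" "card S < card (odd_labels (X - S) c)" using bar by (auto simp: barrier_def)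
  moreover have "card (X - S) + card S = card X"
    using fin \<open>S \<subseteq> X\<close> card_mono[of X S] by (simp add: card_Diff_subset finite_subset)
  moreover have "even (card (X - S)) \<longleftrightarrow> even (card (odd_labels (X - S) c))"
    using fin by (intro even_card_iff_even_odd_labels) auto
  ultimately have "even (card S) \<longleftrightarrow> even (card (odd_labels (X - S) c))"
    using \<open>even (card X)\<close> by (metis even_add)
  then have "card (odd_labels (X - S) c) \<noteq> Suc (card S)" by auto
  then show ?thesis using \<open>card S < _\<close> by simp
qed

lemma barrier_with_three_labels:
  fixes R :: "('a \<times> 'a) set"
  assumes "finite X" and "even (card X)" and "sym R" and "R \<subseteq> X \<times> X"
    and "\<not> matchable R X"
  obtains S and c :: "'a \<Rightarrow> 'a set" where "barrier R X S c"
    and "\<And>x l1 l2. x \<in> S \<Longrightarrow> \<exists>y\<in>X - S. (x, y) \<in> R \<and> c y \<notin> {l1, l2}"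
proof -
  let ?P = "\<lambda>S. \<exists>c :: 'a \<Rightarrow> 'a set. barrier R X S c"
  have "\<exists>S. ?P S" using barrier_if_not_matchable assms by blast
  then obtain S where S: "?P S" "\<And>S'. ?P S' \<Longrightarrow> card S \<le> card S'"
    using ex_has_least_nat[of ?P _ card] by blast
  then obtain c :: "'a \<Rightarrow> 'a set" where c: "barrier R X S c" by blast
  show thesis
  proof (rule that[OF c])
    fix x l1 l2 assume "x \<in> S"
    have "finite S" using c \<open>finite X\<close> by (auto simp: barrier_def intro: finite_subset)
    then have "card (S - {x}) < card S" using \<open>x \<in> S\<close> by (metis card_Diff1_less)
    then have "\<not> ?P (S - {x})" using S(2) by (meson linorder_not_less)
    then have "\<not> (\<forall>y\<in>X - S. (x, y) \<in> R \<longrightarrow> c y \<in> {l1, l2})"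
      using barrier_remove[OF \<open>finite X\<close> c \<open>sym R\<close> \<open>x \<in> S\<close>, of l1 l2] by metis
    then show "\<exists>y\<in>X - S. (x, y) \<in> R \<and> c y \<notin> {l1, l2}" by blast
  qed
qed

section \<open>Matchings that choose two vertices from every hyperedge\<close>

datatype ('v, 'e) node = Slot 'v 'e | Dummy nat 'e

definition gadget_nodes :: "nat \<Rightarrow> ('e \<Rightarrow> 'v set) \<Rightarrow> 'e set \<Rightarrow> ('v, 'e) node set" where
  "gadget_nodes k I E =
     (\<lambda>(e, v). Slot v e) ` (SIGMA e:E. I e) \<union> (\<lambda>(e, i). Dummy i e) ` (E \<times> {..<k - 2})"

text \<open>
  The loops at slots are harmless and make the description uniform.
\<close>

definition gadget_edges ::
    "nat \<Rightarrow> ('e \<Rightarrow> 'v set) \<Rightarrow> 'e set \<Rightarrow> (('v, 'e) node \<times> ('v, 'e) node) set" where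
  "gadget_edges k I E = {(x, y) \<in> gadget_nodes k I E \<times> gadget_nodes k I E.
     case x of
       Slot v e \<Rightarrow> (case y of Slot w f \<Rightarrow> v = w | Dummy i f \<Rightarrow> e = f)
     | Dummy i e \<Rightarrow> (case y of Slot w f \<Rightarrow> e = f | Dummy j f \<Rightarrow> False)}"

text \<open>
  The pairs \<open>p e\<close> are read as the edges of a multigraph; the last condition says that it is even.
\<close>

definition even_choice :: "('e \<Rightarrow> 'v set) \<Rightarrow> 'e set \<Rightarrow> ('e \<Rightarrow> 'v set) \<Rightarrow> bool" where
  "even_choice I E p \<longleftrightarrow>
     (\<forall>e\<in>E. p e \<subseteq> I e \<and> card (p e) = 2) \<and> (\<forall>v. even (card {e \<in> E. v \<in> p e}))"

lemma in_gadget_nodes [simp]: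
  "Slot v e \<in> gadget_nodes k I E \<longleftrightarrow> e \<in> E \<and> v \<in> I e"
  "Dummy i e \<in> gadget_nodes k I E \<longleftrightarrow> e \<in> E \<and> i < k - 2"
  by (auto simp: gadget_nodes_def)

lemma in_gadget_edges [simp]:
  "(Slot v e, Slot w f) \<in> gadget_edges k I E \<longleftrightarrow> e \<in> E \<and> f \<in> E \<and> v \<in> I e \<and> w \<in> I f \<and> v = w"
  "(Slot v e, Dummy i f) \<in> gadget_edges k I E \<longleftrightarrow> e \<in> E \<and> v \<in> I e \<and> i < k - 2 \<and> e = f"
  "(Dummy i e, Slot w f) \<in> gadget_edges k I E \<longleftrightarrow> e \<in> E \<and> w \<in> I f \<and> i < k - 2 \<and> e = f"
  "(Dummy i e, Dummy j f) \<notin> gadget_edges k I E"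
  by (auto simp: gadget_edges_def)

lemma sym_gadget_edges: "sym (gadget_edges k I E)"
  by (auto simp: sym_def gadget_edges_def split: node.splits)

lemma card_slots:
  assumes "finite E" "\<And>e. e \<in> E \<Longrightarrow> finite (I e) \<and> card (I e) = k"
  shows "card ((\<lambda>(e, v). Slot v e) ` (SIGMA e:E. I e)) = k * card E"
    "finite (SIGMA e:E. I e)"
proof -
  have "inj_on (\<lambda>(e, v). Slot v e) (SIGMA e:E. I e)" by (auto simp: inj_on_def)
  then show "card ((\<lambda>(e, v). Slot v e) ` (SIGMA e:E. I e)) = k * card E"
    using assms by (simp add: card_image card_SigmaI)
qed (use assms in auto)

lemma card_dummies:
  "card ((\<lambda>(e, i). Dummy i e :: ('v, 'e) node) ` (E \<times> {..<j})) = j * card E"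
proof -
  have "inj_on (\<lambda>(e, i). Dummy i e :: ('v, 'e) node) (E \<times> {..<j})" by (auto simp: inj_on_def)
  then show ?thesis by (simp add: card_image card_cartesian_product mult.commute)
qed

lemma gadget_nodes_finite_even:
  assumes "finite E" "\<And>e. e \<in> E \<Longrightarrow> finite (I e) \<and> card (I e) = k" "k \<ge> 2"
  shows "finite (gadget_nodes k I E)" "even (card (gadget_nodes k I E))"
proof -
  show "finite (gadget_nodes k I E)"
    using card_slots(2)[OF assms(1,2)] assms(1) by (auto simp: gadget_nodes_def)
  have "card (gadget_nodes k I E) = k * card E + (k - 2) * card E"
    unfolding gadget_nodes_def using card_slots[OF assms(1,2)] assms(1)
    by (subst card_Un_disjoint) (auto simp: card_dummies)
  then show "even (card (gadget_nodes k I E))" using \<open>k \<ge> 2\<close> by auto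
qed

lemma even_card_if_perfect_matching:
  assumes "finite X" "perfect_matching R X f"
  shows "even (card X)"
proof -
  have f: "f x \<in> X" "f (f x) = x" "f x \<noteq> x" if "x \<in> X" for x
    using assms that by (auto simp: perfect_matching_def)
  have "{y \<in> X. {y, f y} = {x, f x}} = {x, f x}" if "x \<in> X" for x
    using f that by (auto simp: doubleton_eq_iff)
  then have "even (card {y \<in> X. {y, f y} = {x, f x}})" if "x \<in> X" for x
    using f[OF that] that by simp
  then show ?thesis
    using matchable_even_classes[of X UNIV "\<lambda>x. {x, f x}"] \<open>finite X\<close> by (auto simp: sym_def)
qed

text \<open>
  The \<open>k - 2\<close> dummies of an edge occupy all but two of its slots. A remaining slot is matched to another
  remaining slot of the same vertex, so the chosen incidences at a vertex come in pairs.
\<close>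

lemma even_choice_if_gadget_matchable:
  assumes "finite E" and I: "\<And>e. e \<in> E \<Longrightarrow> finite (I e) \<and> card (I e) = k" and "k \<ge> 2"
    and "matchable (gadget_edges k I E) (gadget_nodes k I E)"
  shows "\<exists>p. even_choice I E p"
proof -
  let ?N = "gadget_nodes k I E" and ?R = "gadget_edges k I E"
  obtain f where f: "\<And>x. x \<in> ?N \<Longrightarrow> f x \<in> ?N \<and> f (f x) = x \<and> f x \<noteq> x \<and> (x, f x) \<in> ?R"
    using assms(4) by (auto simp: matchable_def perfect_matching_def)
  define p where "p e = {v \<in> I e. \<exists>g. f (Slot v e) = Slot v g}" for e
  have card_p: "card (p e) = 2" if e: "e \<in> E" for e
  proof -
    let ?D = "(\<lambda>i. Dummy i e) ` {..<k - 2}"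
    have "f ` ?D = (\<lambda>v. Slot v e) ` (I e - p e)"
    proof (intro equalityI subsetI)
      fix y assume "y \<in> f ` ?D"
      then obtain i where i: "i < k - 2" "y = f (Dummy i e)" by blast
      have D: "Dummy i e \<in> ?N" using e i by simp
      then obtain v where v: "y = Slot v e" "v \<in> I e"
        using f[OF D] i by (cases "f (Dummy i e)") auto
      moreover have "f y = Dummy i e" using f[OF D] i by simp
      ultimately show "y \<in> (\<lambda>v. Slot v e) ` (I e - p e)" by (auto simp: p_def)
    next
      fix y assume "y \<in> (\<lambda>v. Slot v e) ` (I e - p e)"
      then obtain v where v: "y = Slot v e" "v \<in> I e" "v \<notin> p e" by blast
      then have y: "y \<in> ?N" using e by simp
      obtain i where i: "f y = Dummy i e" "i < k - 2"
        using f[OF y] v by (cases "f y") (auto simp: p_def)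
      then have "y = f (Dummy i e)" using f[OF y] by simp
      then show "y \<in> f ` ?D" using i by auto
    qed
    moreover have "inj_on f ?D"
    proof (rule inj_on_inverseI)
      show "f (f x) = x" if "x \<in> ?D" for x using f[of x] that e by auto
    qed
    moreover have "card ?D = k - 2" by (simp add: card_image inj_on_def)
    moreover have "inj_on (\<lambda>v. Slot v e) (I e - p e)" by (simp add: inj_on_def)
    ultimately have "card (I e - p e) = k - 2" by (metis card_image)
    moreover have "p e \<subseteq> I e" by (auto simp: p_def)
    then have "card (I e - p e) = k - card (p e)" "card (p e) \<le> k"
      using I[OF e] by (auto simp: card_Diff_subset finite_subset intro: card_mono)
    ultimately show ?thesis using \<open>k \<ge> 2\<close> by simp
  qed
  have "even (card {e \<in> E. v \<in> p e})" for v
  proof -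
    let ?X = "Slot v ` {e \<in> E. v \<in> p e}"
    have "f x \<in> ?X \<and> f (f x) = x \<and> f x \<noteq> x" if x: "x \<in> ?X" for x
    proof -
      obtain e g where e: "x = Slot v e" "e \<in> E" "v \<in> I e" "f x = Slot v g"
        using x by (auto simp: p_def)
      then have "x \<in> ?N" by simp
      note fx = f[OF this]
      then have "g \<in> E" "v \<in> I g" "f (Slot v g) = Slot v e" using e by auto
      then show ?thesis using fx e by (auto simp: p_def)
    qed
    then have "perfect_matching UNIV ?X f" by (auto simp: perfect_matching_def)
    then have "even (card ?X)" using \<open>finite E\<close> by (intro even_card_if_perfect_matching) auto
    then show ?thesis by (simp add: card_image inj_on_def)
  qed
  then have "even_choice I E p" using card_p by (auto simp: even_choice_def p_def)
  then show ?thesis by blast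
qed

text \<open>
  A smallest barrier of the gadget is described by the hypergraph. A slot sees only two kinds of
  nodes, the other slots of its vertex, which form a clique, and the dummies of its edge; to see three
  labels it needs dummies with different labels, which is possible only if all slots of its edge are
  removed. Similarly a dummy sees three labels only if no dummy of its edge is left to join the slots.
  Each edge in \<open>A\<close> thus costs \<open>k\<close> nodes and isolates \<open>k - 2\<close> dummies, a net cost of two, and each edge
  in \<open>B\<close> costs \<open>k - 2\<close>. An odd label that is not due to such a dummy has to meet an edge in \<open>B\<close>, because an
  edge that avoids the barrier contributes all its \<open>2 k - 2\<close> nodes to one label.
\<close>

theorem even_choice_or_obstruction:
  fixes I :: "'e \<Rightarrow> 'v set"
  assumes "finite E" and I: "\<And>e. e \<in> E \<Longrightarrow> finite (I e) \<and> card (I e) = k" and "k \<ge> 3"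
    and no: "\<nexists>p. even_choice I E p"
  obtains A B and L :: "'v \<Rightarrow> ('v, 'e) node set"
  where "A \<subseteq> E" "B \<subseteq> E" "A \<inter> B = {}"
    "\<And>e u v. e \<in> E - A - B \<Longrightarrow> u \<in> I e \<Longrightarrow> v \<in> I e \<Longrightarrow> L u = L v"
    "2 * card A + (k - 2) * card B + 2 \<le> card (L ` \<Union>(I ` B))"
proof -
  let ?N = "gadget_nodes k I" and ?R = "gadget_edges k I E"
  let ?slots = "\<lambda>E. (\<lambda>(e, v). Slot v e) ` (SIGMA e:E. I e)"
  let ?dummies = "\<lambda>E. (\<lambda>(e, i). Dummy i e :: ('v, 'e) node) ` (E \<times> {..<k - 2})"
  have k: "k \<ge> 2" "0 < k - 2" using \<open>k \<ge> 3\<close> by auto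
  have fin: "finite (?N E)" "even (card (?N E))"
    using gadget_nodes_finite_even[of E I k] \<open>finite E\<close> I k(1) by auto
  have "\<not> matchable ?R (?N E)"
    using even_choice_if_gadget_matchable[of E I k] \<open>finite E\<close> I k(1) no by blast
  moreover have "?R \<subseteq> ?N E \<times> ?N E" by (auto simp: gadget_edges_def)
  ultimately obtain S and c :: "('v, 'e) node \<Rightarrow> ('v, 'e) node set"
    where bar: "barrier ?R (?N E) S c"
    and three: "\<And>x l1 l2. x \<in> S \<Longrightarrow> \<exists>y\<in>?N E - S. (x, y) \<in> ?R \<and> c y \<notin> {l1, l2}"
    using barrier_with_three_labels[of "?N E" ?R] fin sym_gadget_edges by metis
  have SN: "S \<subseteq> ?N E" using bar by (simp add: barrier_def)
  have c: "c x = c y" if "x \<in> ?N E - S" "y \<in> ?N E - S" "(x, y) \<in> ?R" for x y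
    using bar that by (auto simp: barrier_def)
  have all_slots: "Slot w e \<in> S" if v: "Slot v e \<in> S" "w \<in> I e" for v w e
  proof (rule ccontr)
    assume w: "Slot w e \<notin> S"
    have e: "e \<in> E" using SN that by auto
    have ex: "\<exists>f. Slot v f \<in> ?N E - S \<and> c (Slot v f) \<noteq> l" for l
    proof -
      obtain y where y: "y \<in> ?N E - S" "(Slot v e, y) \<in> ?R" "c y \<noteq> c (Slot w e)" "c y \<noteq> l"
        using three[OF v(1), of "c (Slot w e)" l] by auto
      have "y \<noteq> Dummy i e" for i
        using c[of y "Slot w e"] y w e that by auto
      then obtain f where "y = Slot v f" using y(2) by (cases y) auto
      then show ?thesis using y by blast
    qed
    then obtain f where f: "Slot v f \<in> ?N E - S" by blast
    obtain g where g: "Slot v g \<in> ?N E - S" "c (Slot v g) \<noteq> c (Slot v f)"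
      using ex by blast
    have "(Slot v g, Slot v f) \<in> ?R" using f g by simp
    then show False using c[OF g(1) f] g by simp
  qed
  have all_dummies: "Dummy j e \<in> S" if i: "Dummy i e \<in> S" "j < k - 2" for i j e
  proof (rule ccontr)
    assume j: "Dummy j e \<notin> S"
    have e: "e \<in> E" using SN that by auto
    obtain y where y: "y \<in> ?N E - S" "(Dummy i e, y) \<in> ?R" "c y \<noteq> c (Dummy j e)"
      using three[OF i(1), of "c (Dummy j e)" "c (Dummy j e)"] by auto
    then obtain w where "y = Slot w e" by (cases y) auto
    then show False using c[of y "Dummy j e"] y j e that by auto
  qed
  have not_both: "Slot v e \<notin> S" if i: "Dummy i e \<in> S" for i v e
  proof
    assume v: "Slot v e \<in> S"
    obtain y where y: "y \<in> ?N E - S" "(Dummy i e, y) \<in> ?R"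
      using three[OF i] by blast
    then obtain w where "y = Slot w e" by (cases y) auto
    then show False using all_slots[OF v, of w] y by auto
  qed
  define A where "A = {e \<in> E. \<exists>v. Slot v e \<in> S}"
  define B where "B = {e \<in> E. Dummy 0 e \<in> S}"
  have AE: "A \<subseteq> E" and BE: "B \<subseteq> E" and AB: "A \<inter> B = {}"
    using not_both by (auto simp: A_def B_def)
  have finAB: "finite A" "finite B" using AE BE \<open>finite E\<close> finite_subset by blast+
  have S_slot: "Slot v e \<in> S \<longleftrightarrow> e \<in> A \<and> v \<in> I e" for v e
    using all_slots SN by (auto simp: A_def)
  have S_dummy: "Dummy i e \<in> S \<longleftrightarrow> e \<in> B \<and> i < k - 2" for i e
    using all_dummies SN k by (auto simp: B_def)
  have "x \<in> S \<longleftrightarrow> x \<in> ?slots A \<union> ?dummies B" for x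
    by (cases x) (auto simp: S_slot S_dummy)
  then have "S = ?slots A \<union> ?dummies B" by blast
  moreover have "card (?slots A) = k * card A" "finite (?slots A)"
    using card_slots[of A I k] I AE finAB by auto
  moreover have "card (?dummies B) = (k - 2) * card B" by (rule card_dummies)
  moreover have "?slots A \<inter> ?dummies B = {}" by auto
  ultimately have card_S: "card S = k * card A + (k - 2) * card B"
    using finAB by (simp add: card_Un_disjoint)
  \<comment> \<open>All remaining slots of \<open>v\<close> have the same label, so any of them defines the label of \<open>v\<close>;
    if no slot of \<open>v\<close> remains, the value is arbitrary.\<close>
  define L where "L v = c (Slot v (SOME e. e \<in> E - A \<and> v \<in> I e))" for v
  have L: "c (Slot v e) = L v" if "e \<in> E - A" "v \<in> I e" for e v
  proof -
    define f where "f = (SOME f. f \<in> E - A \<and> v \<in> I f)"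
    have f: "f \<in> E - A \<and> v \<in> I f" unfolding f_def by (rule someI) (use that in blast)
    then have "c (Slot v e) = c (Slot v f)" using that by (intro c) (auto simp: S_slot)
    then show ?thesis by (simp add: L_def f_def)
  qed
  have C_slot: "c (Slot v e) = c (Dummy 0 e)" if "e \<in> E - A - B" "v \<in> I e" for e v
    using that k by (intro c) (auto simp: S_slot S_dummy)
  have C_dummy: "c (Dummy i e) = c (Dummy 0 e)" if "e \<in> E - A - B" "i < k - 2" for e i
  proof -
    have "I e \<noteq> {}" using I[of e] that k by auto
    then obtain v where v: "v \<in> I e" by blast
    then have "c (Slot v e) = c (Dummy i e)"
      using that by (intro c) (auto simp: S_slot S_dummy)
    then show ?thesis using C_slot[OF that(1) v] by simp
  qed
  let ?O = "odd_labels (?N E - S) c"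
  have "?O \<subseteq> c ` ?dummies A \<union> L ` \<Union>(I ` B)"
  proof
    fix l assume l: "l \<in> ?O"
    show "l \<in> c ` ?dummies A \<union> L ` \<Union>(I ` B)"
    proof (rule ccontr)
      assume notin: "l \<notin> c ` ?dummies A \<union> L ` \<Union>(I ` B)"
      let ?C = "{e \<in> E - A - B. c (Dummy 0 e) = l}"
      have "x \<in> ?N E - S \<and> c x = l \<longleftrightarrow> x \<in> ?N ?C" for x
      proof (cases x)
        case (Slot v e)
        have "e \<notin> B" if "e \<in> E" "e \<notin> A" "v \<in> I e" "c (Slot v e) = l"
          using L[of e v] that notin by auto
        then show ?thesis using Slot C_slot by (auto simp: S_slot)
      next
        case (Dummy i e)
        have "e \<notin> A" if "i < k - 2" "c (Dummy i e) = l"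
          using that notin by force
        then show ?thesis using Dummy C_dummy by (auto simp: S_dummy)
      qed
      then have "{x \<in> ?N E - S. c x = l} = ?N ?C" by blast
      moreover have "even (card (?N ?C))"
        by (rule gadget_nodes_finite_even) (use \<open>finite E\<close> I k in auto)
      ultimately show False using l by (simp add: odd_labels_def)
    qed
  qed
  moreover have fin_union: "finite (L ` \<Union>(I ` B))" using I BE finAB by auto
  ultimately have "card ?O \<le> card (c ` ?dummies A \<union> L ` \<Union>(I ` B))"
    using finAB by (intro card_mono) auto
  also have "\<dots> \<le> card (c ` ?dummies A) + card (L ` \<Union>(I ` B))" by (rule card_Un_le)
  also have "card (c ` ?dummies A) \<le> card (?dummies A)" using finAB by (intro card_image_le) auto
  also have "card (?dummies A) = (k - 2) * card A" by (rule card_dummies)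
  finally have "card ?O \<le> (k - 2) * card A + card (L ` \<Union>(I ` B))" by simp
  moreover have "card S + 2 \<le> card ?O" using barrier_surplus fin bar by blast
  moreover have "k * card A = 2 * card A + (k - 2) * card A"
  proof -
    have "2 + (k - 2) = k" using k by simp
    then show ?thesis by (metis add_mult_distrib)
  qed
  ultimately have "2 * card A + (k - 2) * card B + 2 \<le> card (L ` \<Union>(I ` B))"
    using card_S by linarith
  moreover have "L u = L v" if "e \<in> E - A - B" "u \<in> I e" "v \<in> I e" for e u v
    using C_slot[OF that(1)] L that by (metis DiffD1)
  ultimately show thesis using that AE BE AB by blast
qed

section \<open>Counting pairs in a covering hypergraph\<close>

text \<open>
  The left side bounds the ordered pairs that \<open>a + b\<close> edges can cover, the right side counts those
  among \<open>t\<close> vertices. After the substitutions \<open>k = 4 + i\<close> and \<open>b = 2 + q\<close>, or \<open>a = a' + 1\<close> and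
  \<open>b = a' + 2 + q\<close>, the inequality holds coefficient by coefficient.
\<close>

lemma obstruction_too_many_pairs:
  fixes a b k t :: nat
  assumes "k \<ge> 4" "a + 1 \<le> b" "2 \<le> b" "2 * a + (k - 2) * b + 2 \<le> t"
  shows "(a + b) * (k * (k - 1)) < t * (t - 1)"
proof -
  define T where "T = 2 * a + (k - 2) * b + 2"
  obtain i where k: "k = 4 + i" using \<open>k \<ge> 4\<close> le_Suc_ex by blast
  have "(a + b) * (k * (k - 1)) < T * (T - 1)"
  proof (cases a)
    case 0
    obtain q where "b = 2 + q" using \<open>2 \<le> b\<close> le_Suc_ex by blast
    then show ?thesis using 0 k by (simp add: T_def algebra_simps)
  next
    case (Suc a')
    then obtain q where "b = 2 + a' + q" using \<open>a + 1 \<le> b\<close> le_Suc_ex[of "2 + a'" b] by auto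
    then show ?thesis using Suc k by (simp add: T_def algebra_simps)
  qed
  also have "\<dots> \<le> t * (t - 1)" using assms(4) by (intro mult_le_mono) (auto simp: T_def)
  finally show ?thesis .
qed

lemma card_off_diagonal:
  assumes "finite X"
  shows "card {(x, y) \<in> X \<times> X. x \<noteq> y} = card X * (card X - 1)"
proof -
  have "{(x, y) \<in> X \<times> X. x \<noteq> y} = (SIGMA x:X. X - {x})" by auto
  then show ?thesis using assms by (simp add: card_SigmaI)
qed

theorem even_choice_if_pairs_covered:
  fixes I :: "'e \<Rightarrow> 'v set"
  assumes "finite E" "finite V" and "k \<ge> 4" and "card E \<ge> 2"
    and I: "\<And>e. e \<in> E \<Longrightarrow> I e \<subseteq> V \<and> card (I e) = k"
    and cover: "\<And>x y. x \<in> V \<Longrightarrow> y \<in> V \<Longrightarrow> x \<noteq> y \<Longrightarrow> \<exists>e\<in>E. x \<in> I e \<and> y \<in> I e"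
  shows "\<exists>p. even_choice I E p"
proof (rule ccontr)
  assume no: "\<nexists>p. even_choice I E p"
  have fI: "finite (I e) \<and> card (I e) = k" if "e \<in> E" for e
    using I[OF that] \<open>finite V\<close> finite_subset by blast
  have "k \<ge> 3" using \<open>k \<ge> 4\<close> by simp
  obtain A B and L :: "'v \<Rightarrow> ('v, 'e) node set"
    where AB: "A \<subseteq> E" "B \<subseteq> E" "A \<inter> B = {}"
    and L: "\<And>e u v. e \<in> E - A - B \<Longrightarrow> u \<in> I e \<Longrightarrow> v \<in> I e \<Longrightarrow> L u = L v"
    and many: "2 * card A + (k - 2) * card B + 2 \<le> card (L ` \<Union>(I ` B))"
    using even_choice_or_obstruction[OF \<open>finite E\<close> fI \<open>k \<ge> 3\<close> no] by metis
  \<comment> \<open>\<open>X\<close> contains one vertex for each label that occurs in an edge of \<open>B\<close>.\<close>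
  obtain X where X: "X \<subseteq> \<Union>(I ` B)" "inj_on L X" "L ` \<Union>(I ` B) = L ` X"
    using subset_image_inj[of "L ` \<Union>(I ` B)" L "\<Union>(I ` B)"] by (metis order_refl)
  have "\<Union>(I ` B) \<subseteq> V" using I AB(2) by (intro UN_least) auto
  then have XV: "X \<subseteq> V" using X(1) by (rule order_trans[rotated])
  have finX: "finite X" by (rule finite_subset[OF XV \<open>finite V\<close>])
  have finAB: "finite A" "finite B"
    using AB(1,2) \<open>finite E\<close> by (auto intro: finite_subset)
  have large: "2 * card A + (k - 2) * card B + 2 \<le> card X"
    using many X by (simp add: card_image)
  have "card X \<le> card (\<Union>(I ` B))"
    using X finAB fI AB by (intro card_mono) auto
  also have "\<dots> \<le> (\<Sum>e\<in>B. card (I e))" using finAB by (intro card_UN_le)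
  also have "\<dots> = (\<Sum>e\<in>B. k)" by (intro sum.cong refl) (use fI AB in auto)
  finally have "card X \<le> k * card B" by (simp add: mult.commute)
  moreover have "2 + (k - 2) = k" using \<open>k \<ge> 4\<close> by simp
  then have "k * card B = 2 * card B + (k - 2) * card B" by (metis add_mult_distrib)
  ultimately have less: "card A + 1 \<le> card B" using large by linarith
  let ?D = "\<lambda>S :: 'v set. {(x, y) \<in> S \<times> S. x \<noteq> y}"
  have pairs: "?D X \<subseteq> (\<Union>e\<in>A \<union> B. ?D (I e))"
  proof clarify
    fix x y assume xy: "x \<in> X" "y \<in> X" "x \<noteq> y"
    then obtain e where e: "e \<in> E" "x \<in> I e" "y \<in> I e" using cover[of x y] XV by blast
    have "L x \<noteq> L y" using xy X(2) by (auto dest: inj_onD)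
    then have "e \<in> A \<union> B" using L[of e x y] e by blast
    then show "(x, y) \<in> (\<Union>e\<in>A \<union> B. ?D (I e))" using e xy by auto
  qed
  have ABE: "e \<in> E" if "e \<in> A \<union> B" for e using that AB(1,2) by auto
  have card_D: "finite (?D (I e))" "card (?D (I e)) = k * (k - 1)" if "e \<in> A \<union> B" for e
    using card_off_diagonal[of "I e"] fI[OF ABE[OF that]]
    by (auto intro: finite_subset[of _ "I e \<times> I e"])
  have "card X * (card X - 1) = card (?D X)" using card_off_diagonal[OF finX] by simp
  also have "\<dots> \<le> card (\<Union>e\<in>A \<union> B. ?D (I e))"
    by (rule card_mono[OF finite_UN_I pairs]) (use finAB card_D(1) in auto)
  also have "\<dots> \<le> (\<Sum>e\<in>A \<union> B. card (?D (I e)))"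
    using finAB by (intro card_UN_le) auto
  also have "\<dots> = (\<Sum>e\<in>A \<union> B. k * (k - 1))"
    by (intro sum.cong refl card_D(2))
  also have "\<dots> = (card A + card B) * (k * (k - 1))"
    using AB finAB by (simp add: card_Un_disjoint)
  finally have "\<not> 2 \<le> card B"
    using obstruction_too_many_pairs[OF \<open>k \<ge> 4\<close> less _ large] by linarith
  \<comment> \<open>The count leaves a single edge \<open>e\<close> in \<open>B\<close>, and then \<open>X\<close> lies in \<open>e\<close>.\<close>
  then have "card B = 1" "card A = 0" using less by auto
  then obtain e where e: "B = {e}" "A = {}" using finAB by (auto simp: card_1_singleton_iff)
  have L_eq: "L x = L y" if "f \<in> E" "f \<noteq> e" "x \<in> I f" "y \<in> I f" for f x y
    using L[of f x y] that e by blast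
  have "card X \<ge> 2" using large by simp
  then obtain x y where xy: "x \<in> X" "y \<in> X" "x \<noteq> y"
    by (metis card_le_Suc0_iff_eq finX not_less_eq_eq numeral_2_eq_2)
  have "L x = L y"
  proof (cases "V \<subseteq> I e")
    case True
    have "E \<noteq> {e}" "E \<noteq> {}" using \<open>card E \<ge> 2\<close> by auto
    then obtain f where f: "f \<in> E" "f \<noteq> e" by blast
    have "e \<in> E" using AB e by blast
    then have "card V = k" using True I by (metis subset_antisym)
    then have "I f = V" using f I \<open>finite V\<close> by (metis card_subset_eq)
    then show ?thesis using L_eq[OF f] xy XV by blast
  next
    case False
    then obtain v where v: "v \<in> V" "v \<notin> I e" by blast
    have Lv: "L z = L v" if z: "z \<in> X" for z
    proof -
      have "z \<in> V" "z \<noteq> v" using z X e XV v by auto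
      then obtain f where "f \<in> E" "z \<in> I f" "v \<in> I f" using cover v by blast
      then show ?thesis using L_eq[of f z v] v by blast
    qed
    show ?thesis using Lv xy by metis
  qed
  then show False using xy X(2) by (auto dest: inj_onD)
qed

section \<open>From an even choice to an Euler family\<close>

text \<open>
  Walks in the multigraph with edges \<open>p e\<close>, defined by recursion so that splitting and concatenating
  need no index arithmetic.
\<close>

fun route :: "('e \<Rightarrow> 'v set) \<Rightarrow> 'v list \<Rightarrow> 'e list \<Rightarrow> bool" where
  "route p [v] [] \<longleftrightarrow> True"
| "route p (v # w # vs) (e # es) \<longleftrightarrow> p e = {v, w} \<and> v \<noteq> w \<and> route p (w # vs) es"
| "route p _ _ \<longleftrightarrow> False"

lemma route_Cons_iff:
  "route p (v # w # vs) es \<longleftrightarrow>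
     (\<exists>e es'. es = e # es' \<and> p e = {v, w} \<and> v \<noteq> w \<and> route p (w # vs) es')"
  by (cases es) auto

lemma route_single_iff: "route p [v] es \<longleftrightarrow> es = []"
  by (cases es) auto

lemma route_steps:
  assumes "route p vs es"
  shows "length vs = Suc (length es)"
    and "\<And>i. i < length es \<Longrightarrow> vs ! i \<noteq> vs ! Suc i \<and> p (es ! i) = {vs ! i, vs ! Suc i}"
proof -
  from assms have "length vs = Suc (length es) \<and>
    (\<forall>i<length es. vs ! i \<noteq> vs ! Suc i \<and> p (es ! i) = {vs ! i, vs ! Suc i})"
    by (induction p vs es rule: route.induct) (auto simp: less_Suc_eq_0_disj)
  then show "length vs = Suc (length es)"
    and "\<And>i. i < length es \<Longrightarrow> vs ! i \<noteq> vs ! Suc i \<and> p (es ! i) = {vs ! i, vs ! Suc i}"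
    by blast+
qed

lemma route_anchors:
  assumes "route p vs es" "es \<noteq> []"
  shows "set vs = \<Union>(p ` set es)"
  using assms
proof (induction p vs es rule: route.induct)
  case (2 p v w vs e es)
  then show ?case by (cases "es = []"; cases vs) auto
qed auto

lemma route_append:
  assumes "route p (xs @ [v]) es" "route p (v # ys) fs"
  shows "route p (xs @ v # ys) (es @ fs)"
  using assms(1)
proof (induction xs arbitrary: es)
  case Nil
  then show ?case using assms(2) by (simp add: route_single_iff)
next
  case (Cons x xs)
  obtain w ws where ws: "xs @ [v] = w # ws" by (cases xs) auto
  then obtain ws' where ws': "xs @ v # ys = w # ws'" by (cases xs) auto
  from Cons.prems ws obtain e es' where e: "es = e # es'" "p e = {x, w}" "x \<noteq> w" "route p (w # ws) es'"
    by (auto simp: route_Cons_iff)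
  then have "route p (xs @ v # ys) (es' @ fs)" using Cons.IH ws by simp
  then show ?case using e ws' by simp
qed

lemma route_split:
  assumes "route p (xs @ v # ys) es"
  obtains es1 es2 where "es = es1 @ es2" "route p (xs @ [v]) es1" "route p (v # ys) es2"
  using assms
proof (induction xs arbitrary: es thesis)
  case Nil
  show ?case by (rule Nil(1)[of "[]" es]) (use Nil in auto)
next
  case (Cons x xs)
  obtain w ws where ws: "xs @ v # ys = w # ws" by (cases xs) auto
  then obtain ws' where ws': "xs @ [v] = w # ws'" by (cases xs) auto
  from Cons.prems(2) ws obtain e es' where e: "es = e # es'" "p e = {x, w}" "x \<noteq> w" "route p (w # ws) es'"
    by (auto simp: route_Cons_iff)
  obtain es1 es2 where "es' = es1 @ es2" "route p (xs @ [v]) es1" "route p (v # ys) es2"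
    using Cons.IH[of es'] e ws by metis
  then show ?case using e ws' by (intro Cons.prems(1)[of "e # es1" es2]) auto
qed

text \<open>
  A trail enters and leaves each of its vertices equally often, except at distinct ends.
\<close>

lemma route_parity:
  assumes "route p vs es" "distinct es"
  shows "odd (card {e \<in> set es. x \<in> p e}) \<longleftrightarrow> (hd vs = x) \<noteq> (last vs = x)"
  using assms
proof (induction p vs es rule: route.induct)
  case (2 p v w vs e es)
  have "{f \<in> set (e # es). x \<in> p f} =
    (if x \<in> p e then insert e {f \<in> set es. x \<in> p f} else {f \<in> set es. x \<in> p f})"
    by auto
  then have "card {f \<in> set (e # es). x \<in> p f} =
    (if x \<in> p e then Suc (card {f \<in> set es. x \<in> p f}) else card {f \<in> set es. x \<in> p f})"
    using 2 by simp
  then show ?case using 2 by (cases "x = v"; cases "x = w") auto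
qed auto

definition closed_route :: "('e \<Rightarrow> 'v set) \<Rightarrow> 'e set \<Rightarrow> 'v list \<Rightarrow> 'e list \<Rightarrow> bool" where
  "closed_route p E vs es \<longleftrightarrow>
     route p vs es \<and> distinct es \<and> es \<noteq> [] \<and> set es \<subseteq> E \<and> hd vs = last vs"

definition even_pairs :: "('e \<Rightarrow> 'v set) \<Rightarrow> 'e set \<Rightarrow> bool" where
  "even_pairs p E \<longleftrightarrow>
     finite E \<and> (\<forall>e\<in>E. card (p e) = 2) \<and> (\<forall>v. even (card {e \<in> E. v \<in> p e}))"

text \<open>
  A longest trail that ends in \<open>v\<close> is closed: if it started at some other vertex \<open>u\<close>, it would use an odd
  number of the edges at \<open>u\<close>, so an unused edge at \<open>u\<close> would extend it. Extending at the start fits the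
  recursion of \<open>route\<close>.
\<close>

lemma closed_route_through:
  assumes E: "even_pairs p E" and "e0 \<in> E" "v \<in> p e0"
  obtains vs es where "closed_route p E vs es" "last vs = v"
proof -
  define P where "P W \<longleftrightarrow> route p (fst W) (snd W) \<and> distinct (snd W) \<and> set (snd W) \<subseteq> E \<and>
    last (fst W) = v" for W
  have finE: "finite E" using E by (simp add: even_pairs_def)
  have "P ([v], [])" by (simp add: P_def)
  moreover have "\<forall>W. P W \<longrightarrow> length (snd W) < Suc (card E)"
    using finE by (metis P_def card_mono distinct_card le_imp_less_Suc)
  ultimately have "\<exists>W. P W \<and> (\<forall>W'. P W' \<longrightarrow> length (snd W') \<le> length (snd W))"
    by (rule ex_has_greatest_nat[where f = "\<lambda>W. length (snd W)"])
  then obtain vs es where route: "route p vs es" "distinct es" "set es \<subseteq> E" "last vs = v"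
    and longest: "\<And>vs' es'. P (vs', es') \<Longrightarrow> length es' \<le> length es"
    by (auto simp: P_def)
  obtain u us where vs: "vs = u # us" using route_steps(1)[OF route(1)] by (cases vs) auto
  have no_ext: "u \<notin> p e" if e: "e \<in> E - set es" for e
  proof
    assume "u \<in> p e"
    moreover have "card (p e) = 2" using E e by (simp add: even_pairs_def)
    ultimately obtain w where "p e = {w, u}" "w \<noteq> u"
      by (metis card_2_iff insertE insert_commute singletonD)
    then have "P (w # vs, e # es)" using route vs e by (auto simp: P_def)
    then show False using longest by force
  qed
  have "hd vs = v"
  proof (rule ccontr)
    assume "hd vs \<noteq> v"
    then have "odd (card {e \<in> set es. u \<in> p e})"
      using route_parity[OF route(1,2), of u] route vs by auto
    moreover have "{e \<in> set es. u \<in> p e} = {e \<in> E. u \<in> p e}" using no_ext route by auto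
    ultimately show False using E by (simp add: even_pairs_def)
  qed
  then have "es \<noteq> []" using no_ext[of e0] assms vs by auto
  then have "closed_route p E vs es" using route \<open>hd vs = v\<close> by (simp add: closed_route_def)
  then show thesis using that route by blast
qed

text \<open>
  Take a longest closed trail. If a remaining edge touched one of its vertices \<open>x\<close>, then the remaining
  edges, which still have even degrees, would contain a closed trail through \<open>x\<close>, and
  splicing it in at \<open>x\<close> would give a longer closed trail. So the remaining edges are vertex-disjoint
  from it, and induction applies to them.
\<close>

lemma euler_family_of_even_pairs:
  assumes "even_pairs p E"
  shows "\<exists>F. (\<forall>(vs, es)\<in>F. closed_route p E vs es) \<and>
     pairwise (\<lambda>W W'. set (snd W) \<inter> set (snd W') = {}) F \<and>
     pairwise (\<lambda>W W'. set (fst W) \<inter> set (fst W') = {}) F \<and> (\<Union>W\<in>F. set (snd W)) = E"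
proof -
  have "finite E" using assms by (simp add: even_pairs_def)
  then show ?thesis using assms
  proof (induction E rule: finite_psubset_induct)
    case (psubset E)
    show ?case
    proof (cases "E = {}")
      case True
      then show ?thesis by (intro exI[of _ "{}"]) auto
    next
      case False
      then obtain e0 where e0: "e0 \<in> E" by blast
      then have "p e0 \<noteq> {}" using psubset.prems by (force simp: even_pairs_def)
      then obtain v0 where "v0 \<in> p e0" by blast
      define P where "P W \<longleftrightarrow> closed_route p E (fst W) (snd W)" for W
      obtain vs0 es0 where "closed_route p E vs0 es0"
        using closed_route_through[OF psubset.prems e0 \<open>v0 \<in> p e0\<close>] by metis
      then have "P (vs0, es0)" by (simp add: P_def)
      moreover have "\<forall>W. P W \<longrightarrow> length (snd W) < Suc (card E)"
        using psubset.hyps by (metis P_def closed_route_def card_mono distinct_card le_imp_less_Suc)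
      ultimately have "\<exists>W. P W \<and> (\<forall>W'. P W' \<longrightarrow> length (snd W') \<le> length (snd W))"
        by (rule ex_has_greatest_nat[where f = "\<lambda>W. length (snd W)"])
      then obtain vs es where closed: "closed_route p E vs es"
        and longest: "\<And>vs' es'. closed_route p E vs' es' \<Longrightarrow> length es' \<le> length es"
        by (auto simp: P_def)
      then have es: "route p vs es" "distinct es" "es \<noteq> []" "set es \<subseteq> E" "hd vs = last vs"
        by (auto simp: closed_route_def)
      let ?E = "E - set es"
      have even_rest: "even_pairs p ?E"
      proof -
        have even_diff: "even a" if "a + b = c" "even b" "even c" for a b c :: nat
          using that by (metis even_add)
        have "even (card {e \<in> ?E. x \<in> p e})" for x
        proof -
          have "{e \<in> ?E. x \<in> p e} = {e \<in> E. x \<in> p e} - {e \<in> set es. x \<in> p e}" by auto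
          moreover have "{e \<in> set es. x \<in> p e} \<subseteq> {e \<in> E. x \<in> p e}" using es by auto
          ultimately have "card {e \<in> ?E. x \<in> p e} + card {e \<in> set es. x \<in> p e} = card {e \<in> E. x \<in> p e}"
            using psubset.hyps card_mono[of "{e \<in> E. x \<in> p e}" "{e \<in> set es. x \<in> p e}"]
            by (simp add: card_Diff_subset)
          moreover have "even (card {e \<in> set es. x \<in> p e})"
            using route_parity[OF es(1,2), of x] es by auto
          moreover have "even (card {e \<in> E. x \<in> p e})"
            using psubset.prems by (simp add: even_pairs_def)
          ultimately show ?thesis using even_diff by blast
        qed
        then show ?thesis using psubset.prems by (simp add: even_pairs_def)
      qed
      have avoid: "x \<notin> p e" if x: "x \<in> set vs" and e: "e \<in> ?E" for x e
      proof
        assume "x \<in> p e"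
        obtain ws fs where ws: "closed_route p ?E ws fs" "last ws = x"
          using closed_route_through[OF even_rest e \<open>x \<in> p e\<close>] by blast
        then have fs: "route p ws fs" "distinct fs" "fs \<noteq> []" "set fs \<subseteq> ?E" "hd ws = x"
          by (auto simp: closed_route_def)
        have len: "length ws = Suc (length fs)" by (rule route_steps[OF fs(1)])
        obtain zs where zs: "ws = x # zs" using fs len by (cases ws) auto
        obtain us where us: "ws = us @ [x]" using ws(2) len by (cases ws rule: rev_cases) auto
        have "us \<noteq> []" using us len fs by auto
        obtain xs ys where vs: "vs = xs @ x # ys" using x by (meson split_list)
        obtain es1 es2 where es12: "es = es1 @ es2" "route p (xs @ [x]) es1" "route p (x # ys) es2"
          using route_split es(1) vs by metis
        have "route p (xs @ us @ [x]) (es1 @ fs)"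
          using route_append[OF es12(2), of zs fs] fs(1) zs us by simp
        then have "route p (xs @ us @ x # ys) (es1 @ fs @ es2)"
          using route_append[of p "xs @ us" x "es1 @ fs" ys es2] es12(3) by simp
        moreover have "hd us = x" using us zs \<open>us \<noteq> []\<close> by (cases us) auto
        ultimately have "closed_route p E (xs @ us @ x # ys) (es1 @ fs @ es2)"
          using es fs es12 vs \<open>us \<noteq> []\<close> by (cases xs) (auto simp: closed_route_def)
        then show False using longest[of _ "es1 @ fs @ es2"] es12 fs by auto
      qed
      have "?E \<subset> E" using es by (cases es) auto
      then obtain F where F: "\<forall>(ws, fs)\<in>F. closed_route p ?E ws fs"
        "pairwise (\<lambda>W W'. set (snd W) \<inter> set (snd W') = {}) F"
        "pairwise (\<lambda>W W'. set (fst W) \<inter> set (fst W') = {}) F" "(\<Union>W\<in>F. set (snd W)) = ?E"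
        using psubset.IH[OF \<open>?E \<subset> E\<close> even_rest] by (elim exE conjE) (rule that)
      have disjoint: "set es \<inter> set (snd W) = {} \<and> set vs \<inter> set (fst W) = {}" if "W \<in> F" for W
      proof -
        obtain ws fs where "W = (ws, fs)" by fastforce
        moreover from this that F(1) have "closed_route p ?E ws fs" by auto
        then have fs: "route p ws fs" "fs \<noteq> []" "set fs \<subseteq> ?E" by (simp_all add: closed_route_def)
        then have "set ws = \<Union>(p ` set fs)" by (intro route_anchors)
        ultimately show ?thesis using avoid fs(3) by auto
      qed
      show ?thesis
      proof (intro exI[of _ "insert (vs, es) F"] conjI)
        show "\<forall>(vs, es)\<in>insert (vs, es) F. closed_route p E vs es"
        proof
          fix W assume "W \<in> insert (vs, es) F"
          then consider "W = (vs, es)" | "W \<in> F" by blast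
          then show "case W of (vs, es) \<Rightarrow> closed_route p E vs es"
          proof cases
            case 2
            with F(1) have "case W of (ws, fs) \<Rightarrow> closed_route p ?E ws fs" by (rule bspec)
            then show ?thesis by (auto simp: closed_route_def)
          qed (simp add: closed)
        qed
        show "pairwise (\<lambda>W W'. set (snd W) \<inter> set (snd W') = {}) (insert (vs, es) F)"
          unfolding pairwise_insert using F(2) disjoint by (simp add: Int_commute)
        show "pairwise (\<lambda>W W'. set (fst W) \<inter> set (fst W') = {}) (insert (vs, es) F)"
          unfolding pairwise_insert using F(3) disjoint by (simp add: Int_commute)
        show "(\<Union>W\<in>insert (vs, es) F. set (snd W)) = E"
          unfolding UN_insert F(4) using es(4) by auto
      qed
    qed
  qed
qed

lemma quasi_eulerian_if_even_choice:
  assumes "hypergraph H" and p: "even_choice (inc H) (edges H) p"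
  shows "quasi_eulerian H"
proof -
  have "even_pairs p (edges H)"
    using assms by (auto simp: even_pairs_def even_choice_def hypergraph_def)
  from euler_family_of_even_pairs[OF this]
  obtain F where F: "\<forall>(vs, es)\<in>F. closed_route p (edges H) vs es"
    "pairwise (\<lambda>W W'. set (snd W) \<inter> set (snd W') = {}) F"
    "pairwise (\<lambda>W W'. set (fst W) \<inter> set (fst W') = {}) F" "(\<Union>W\<in>F. set (snd W)) = edges H"
    by (elim exE conjE) (rule that)
  have "strict_trail H W \<and> closed_walk W \<and> \<not> trivial_walk W" if "W \<in> F" for W
  proof -
    obtain vs es where W: "W = (vs, es)" by fastforce
    then have es: "route p vs es" "distinct es" "es \<noteq> []" "set es \<subseteq> edges H" "hd vs = last vs"
      using bspec[OF F(1) that] by (auto simp: closed_route_def)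
    have pI: "p e \<subseteq> inc H e" "inc H e \<subseteq> verts H" if "e \<in> edges H" for e
      using that assms by (auto simp: even_choice_def hypergraph_def)
    have "set vs \<subseteq> verts H" using route_anchors[OF es(1,3)] es(4) pI by blast
    moreover have "vs ! i \<in> inc H (es ! i) \<and> vs ! Suc i \<in> inc H (es ! i)" if "i < length es" for i
      using route_steps(2)[OF es(1) that] pI(1)[of "es ! i"] es(4) that by (force dest: nth_mem)
    ultimately show ?thesis
      using es route_steps[OF es(1)] W
      by (auto simp: strict_trail_def is_walk_def closed_walk_def trivial_walk_def)
  qed
  then have "euler_family H F"
    using F by (auto simp: euler_family_def walk_edges_def anchors_def)
  then show ?thesis by (auto simp: quasi_eulerian_def)
qed

theorem theorem6p1p2:
  fixes k :: nat and H :: "('v, 'e) hypergraph"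
  assumes "k \<ge> 4"
    and "two_covering_hypergraph k H"
    and "hg_order H \<ge> k"
    and "hg_size H \<ge> 2"
  shows "quasi_eulerian H"
proof -
  have H: "hypergraph H" using assms by (simp add: two_covering_hypergraph_def)
  have "\<exists>p. even_choice (inc H) (edges H) p"
  proof (rule even_choice_if_pairs_covered)
    show "finite (edges H)" "finite (verts H)" using H by (auto simp: hypergraph_def)
    show "inc H e \<subseteq> verts H \<and> card (inc H e) = k" if "e \<in> edges H" for e
      using assms H that by (auto simp: two_covering_hypergraph_def hypergraph_def)
    show "\<exists>e\<in>edges H. x \<in> inc H e \<and> y \<in> inc H e"
      if "x \<in> verts H" "y \<in> verts H" "x \<noteq> y" for x y
    proof -
      have "{x, y} \<subseteq> verts H \<and> card {x, y} = 2" using that by auto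
      then obtain e where "e \<in> edges H" "{x, y} \<subseteq> inc H e"
        using assms unfolding two_covering_hypergraph_def by blast
      then show ?thesis by blast
    qed
  qed (use assms in \<open>auto simp: hg_size_def\<close>)
  then show ?thesis using quasi_eulerian_if_even_choice H by blast
qed

end
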